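(* Let $\{\beta_m\}_{m=1}^\infty$ be a sequence of real numbers strictly decreasing to $0$. Then there is a closed and nowhere dense set $A\subseteq[0,1]$, depending on $\{\beta_m\}$, such that for every sequence $\{\alpha_m\}_{m=1}^\infty$ of real numbers with $\alpha_m\to 0$ and $|\alpha_m|=O(\beta_m)$, there exist $\delta>0$ and $t\in\mathbb R$ such that $t+\delta\alpha_m\in A$ for all $m\ge 1$.
   Context: A set $A\subseteq\mathbb R$ is nowhere dense if the interior of its closure is empty. The notation $|\alpha_m|=O(\beta_m)$ means that there is a constant $C$ with $|\alpha_m|\le C\beta_m$ for all $m$. *)

theory Defs
  imports "HOL-Analysis.Analysis"
begin

definition nowhere_dense :: "'a::topological_space set \<Rightarrow> bool" where
  "nowhere_dense A \<longleftrightarrow> interior (closure A) = {}"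

end

theory Submission
  imports Defs
begin

text \<open>
  Remove from \<open>[0,1]\<close> an open interval of radius \<open>l n\<close> around each point \<open>q n\<close> of a dense sequence;
  what remains is closed and nowhere dense.  The radii are chosen so that, for every sequence
  \<open>\<gamma>\<close> with \<open>\<bar>\<gamma> m\<bar> \<le> \<beta> m\<close> and \<open>\<bar>\<gamma> m\<bar> \<le> 1/4\<close>, a translate that misses all the intervals exists by a measure count.

  The naive count fails: a translate \<open>t + \<gamma>\<close> misses the \<open>n\<close>th interval iff \<open>t\<close> avoids infinitely many
  intervals of length \<open>2 * l n\<close>.  The remedy is to forbid first a much longer interval, of radius
  \<open>2 * r n\<close> around \<open>q n\<close>, for the position of \<open>t\<close>.  Since \<open>\<beta>\<close> tends to 0, only the terms of \<open>\<gamma>\<close>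
  up to some index \<open>N n\<close> can bridge a distance of more than \<open>r n\<close>, and \<open>N n\<close> depends on \<open>\<beta>\<close> and \<open>r n\<close> alone.
  So one may choose \<open>l n\<close> after \<open>N n\<close>, as \<open>r n / (N n + 1)\<close>: then the finitely many remaining conditions
  forbid only a set of measure at most \<open>2 * r n\<close>.  All in all \<open>t\<close> has to avoid a set of measure at most
  the sum of the \<open>6 * r n\<close>, which is arbitrarily small, while the radii \<open>l n\<close> do not depend on \<open>\<gamma>\<close>.

  A sequence \<open>\<alpha>\<close> with \<open>\<bar>\<alpha> m\<bar> \<le> C * \<beta> m\<close> becomes such a \<open>\<gamma>\<close> after a dilation, which absorbs the
  constant \<open>C\<close> and also makes the copy short enough to fit into \<open>[0,1]\<close>.
\<close>

lemma exists_point_avoiding_countable_union: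
  fixes E :: "nat \<Rightarrow> real set" and a b :: real
  assumes meas: "\<And>n. E n \<in> sets lborel"
    and small: "\<And>n. emeasure lborel (E n) \<le> ennreal (c n)"
    and nonneg: "\<And>n. 0 \<le> c n" and sums: "c sums s" and "s < b - a"
  obtains t where "t \<in> {a..b}" "\<And>n. t \<notin> E n"
proof -
  have "0 \<le> s"
    using sums_le[OF nonneg sums_zero sums] .
  have "emeasure lborel (\<Union>n. E n) \<le> (\<Sum>n. emeasure lborel (E n))"
    using meas by (intro emeasure_subadditive_countably) auto
  also have "\<dots> \<le> (\<Sum>n. ennreal (c n))"
    using small by (intro suminf_le) auto
  also have "\<dots> = ennreal s"
    using suminf_ennreal_eq[OF nonneg sums] .
  also have "\<dots> < ennreal (b - a)"
    using \<open>0 \<le> s\<close> \<open>s < b - a\<close> by (simp add: ennreal_lessI)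
  also have "\<dots> = emeasure lborel {a..b}"
    using \<open>0 \<le> s\<close> \<open>s < b - a\<close> by simp
  finally have "\<not> {a..b} \<subseteq> (\<Union>n. E n)"
    using emeasure_mono[of "{a..b}" "\<Union>n. E n" lborel] sets.countable_UN[of E UNIV lborel] meas
    by (auto simp: image_subset_iff not_le[symmetric])
  then show ?thesis
    using that by blast
qed

lemma emeasure_lborel_ball_real:
  fixes x r :: real
  assumes "0 \<le> r"
  shows "emeasure lborel (ball x r) = ennreal (2 * r)"
  using assms by (simp add: ball_eq_greaterThanLessThan)

text \<open>
  The set bounded here contains every \<open>t\<close> for which \<open>t + \<gamma>\<close> hits the interval around \<open>x\<close> of radius
  \<open>r / (N + 1)\<close>, if the terms of \<open>\<gamma>\<close> after index \<open>N\<close> are at most \<open>r\<close> in absolute value.  The bound is independent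
  of \<open>N\<close> because the radius of the intervals compensates for their number.
\<close>
lemma emeasure_forbidden_le:
  fixes \<gamma> :: "nat \<Rightarrow> real" and x r :: real and N :: nat
  assumes "0 \<le> r"
  shows "emeasure lborel (ball x (2 * r) \<union> (\<Union>m\<le>N. ball (x - \<gamma> m) (r / (real N + 1)))) \<le> ennreal (6 * r)"
proof -
  let ?l = "r / (real N + 1)"
  have "emeasure lborel (ball x (2 * r) \<union> (\<Union>m\<le>N. ball (x - \<gamma> m) ?l))
      \<le> emeasure lborel (ball x (2 * r)) + emeasure lborel (\<Union>m\<le>N. ball (x - \<gamma> m) ?l)"
    by (intro emeasure_subadditive) auto
  also have "\<dots> \<le> emeasure lborel (ball x (2 * r)) + (\<Sum>m\<le>N. emeasure lborel (ball (x - \<gamma> m) ?l))"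
    by (intro add_left_mono emeasure_subadditive_finite) auto
  also have "\<dots> = ennreal (4 * r) + (\<Sum>m\<le>N. ennreal (2 * ?l))"
    using assms by (simp add: emeasure_lborel_ball_real)
  also have "\<dots> = ennreal (4 * r) + ennreal (\<Sum>m\<le>N. 2 * ?l)"
    using assms by (subst sum_ennreal) auto
  also have "(\<Sum>m\<le>N. 2 * ?l) = 2 * r"
    by (simp add: field_simps)
  also have "ennreal (4 * r) + ennreal (2 * r) = ennreal (6 * r)"
    using assms by (simp flip: ennreal_plus)
  finally show ?thesis .
qed

lemma nowhere_dense_if_misses_dense_sequence:
  fixes A :: "real set" and q :: "nat \<Rightarrow> real"
  assumes "closed A" and rats: "\<rat> \<subseteq> range q" and "\<And>n. q n \<notin> A"
  shows "nowhere_dense A"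
proof (rule ccontr)
  assume "\<not> nowhere_dense A"
  then obtain x where "x \<in> interior A"
    using \<open>closed A\<close> by (auto simp: nowhere_dense_def)
  then obtain e where "e > 0" and sub: "ball x e \<subseteq> A"
    by (auto simp: mem_interior)
  obtain r where r: "r \<in> \<rat>" "x < r" "r < x + e"
    using Rats_dense_in_real[of x "x + e"] \<open>e > 0\<close> by auto
  then have "r \<in> A"
    using sub by (auto simp: dist_real_def)
  with r(1) rats assms(3) show False
    by blast
qed

text \<open>
  The interval \<open>[1/4, 3/4]\<close> for \<open>t\<close> and the bound \<open>1/4\<close> for the terms keep the copy inside \<open>[0,1]\<close>,
  so that only the removed intervals have to be avoided.
\<close>
lemma exists_translate_avoiding_balls:
  fixes q r \<gamma> :: "nat \<Rightarrow> real" and N :: "nat \<Rightarrow> nat"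
  assumes nonneg: "\<And>n. 0 \<le> r n" and sums: "(\<lambda>n. 6 * r n) sums s" and "s < 1/2"
    and tail: "\<And>n m. m > N n \<Longrightarrow> \<bar>\<gamma> m\<bar> \<le> r n"
    and short: "\<And>m. \<bar>\<gamma> m\<bar> \<le> 1/4"
  obtains t where "\<And>m. t + \<gamma> m \<in> {0..1} - (\<Union>n. ball (q n) (r n / (real (N n) + 1)))"
proof -
  define l where "l n = r n / (real (N n) + 1)" for n
  define E where "E n = ball (q n) (2 * r n) \<union> (\<Union>m\<le>N n. ball (q n - \<gamma> m) (l n))" for n
  have l_le: "l n \<le> r n" for n
    using nonneg[of n] by (simp add: l_def divide_le_eq mult_left_mono algebra_simps)
  have "E n \<in> sets lborel" for n
    by (auto simp: E_def)
  moreover have "emeasure lborel (E n) \<le> ennreal (6 * r n)" for n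
    using emeasure_forbidden_le[OF nonneg] by (simp add: E_def l_def)
  ultimately obtain t where t: "t \<in> {1/4..3/4}" and avoid: "\<And>n. t \<notin> E n"
    using exists_point_avoiding_countable_union[of E "\<lambda>n. 6 * r n" s "3/4" "1/4"]
      nonneg sums \<open>s < 1/2\<close> by auto
  have "t + \<gamma> m \<notin> ball (q n) (l n)" for m n
  proof
    assume hit: "t + \<gamma> m \<in> ball (q n) (l n)"
    show False
    proof (cases "m \<le> N n")
      case True
      from hit have "t \<in> ball (q n - \<gamma> m) (l n)"
        by (simp add: dist_real_def algebra_simps)
      with True avoid[of n] show False
        by (auto simp: E_def)
    next
      case False
      then have "\<bar>\<gamma> m\<bar> \<le> r n"
        using tail by simp
      with hit l_le[of n] have "t \<in> ball (q n) (2 * r n)"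
        by (simp add: dist_real_def)
      with avoid[of n] show False
        by (simp add: E_def)
    qed
  qed
  moreover have "t + \<gamma> m \<in> {0..1}" for m
    using t short[of m] by (auto simp: abs_le_iff)
  ultimately show ?thesis
    using that[of t] by (simp add: l_def)
qed

theorem theorem1p2:
  fixes \<beta> :: "nat \<Rightarrow> real"
  assumes "strict_antimono_on {1..} \<beta>"
    and "\<beta> \<longlonglongrightarrow> 0"
  shows "\<exists>A :: real set. A \<subseteq> {0..1} \<and> closed A \<and> nowhere_dense A \<and>
    (\<forall>\<alpha> :: nat \<Rightarrow> real.
      \<alpha> \<longlonglongrightarrow> 0 \<and> (\<exists>C :: real. \<forall>m\<ge>1. \<bar>\<alpha> m\<bar> \<le> C * \<beta> m) \<longrightarrow>
      (\<exists>\<delta> > 0. \<exists>t. \<forall>m\<ge>1. t + \<delta> * \<alpha> m \<in> A))"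
proof -
  define q :: "nat \<Rightarrow> real" where "q n = of_rat (nat_to_rat_surj n)" for n
  \<comment> \<open>With this factor the sum of the \<open>6 * r n\<close> is \<open>3/8\<close>, less than the length of \<open>[1/4, 3/4]\<close>.\<close>
  define r :: "nat \<Rightarrow> real" where "r n = (1/2) ^ n / 32" for n
  have r_pos: "0 < r n" for n
    by (simp add: r_def)
  have r_sums: "(\<lambda>n. 6 * r n) sums (3/8)"
    using sums_mult[OF geometric_sums[of "1/2 :: real"], of "6/32"] by (simp add: r_def)
  have "\<exists>N. \<forall>m>N. \<bar>\<beta> m\<bar> \<le> r n" for n
    using LIMSEQ_D[OF assms(2) r_pos[of n]] by (metis less_imp_le diff_zero real_norm_def)
  then obtain N where N: "\<And>n m. m > N n \<Longrightarrow> \<bar>\<beta> m\<bar> \<le> r n"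
    by metis
  define A where "A = {0..1} - (\<Union>n. ball (q n) (r n / (real (N n) + 1)))"
  have "closed A"
    unfolding A_def by (intro closed_Diff open_UN) auto
  moreover have "nowhere_dense A"
  proof (rule nowhere_dense_if_misses_dense_sequence[of A q])
    show "\<rat> \<subseteq> range q"
      by (auto simp: q_def Rats_def surj_nat_to_rat_surj image_image[symmetric])
    show "q n \<notin> A" for n
      using r_pos[of n] by (auto simp: A_def intro!: exI[of _ n])
  qed fact
  moreover have "\<exists>\<delta> > 0. \<exists>t. \<forall>m\<ge>1. t + \<delta> * \<alpha> m \<in> A"
    if lim: "\<alpha> \<longlonglongrightarrow> 0" and C: "\<forall>m\<ge>1. \<bar>\<alpha> m\<bar> \<le> C * \<beta> m" for \<alpha> C
  proof -
    obtain B where "B > 0" and B: "\<And>m. \<bar>\<alpha> m\<bar> \<le> B"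
      using convergent_imp_Bseq[OF convergentI[OF lim]] by (auto simp: Bseq_def)
    define D where "D = max (4 * B) (\<bar>C\<bar> + 1)"
    have "D > 0" and D: "4 * B \<le> D" "\<bar>C\<bar> \<le> D"
      by (auto simp: D_def)
    have tail: "\<bar>\<alpha> m / D\<bar> \<le> r n" if "m > N n" for n m
    proof -
      have "\<bar>\<alpha> m\<bar> \<le> C * \<beta> m"
        using C that by simp
      also have "\<dots> \<le> \<bar>C\<bar> * \<bar>\<beta> m\<bar>"
        by (metis abs_ge_self abs_mult)
      also have "\<dots> \<le> D * r n"
        using D N[OF that] by (intro mult_mono) auto
      finally show ?thesis
        using \<open>D > 0\<close> by (simp add: abs_divide divide_le_eq mult.commute)
    qed
    have short: "\<bar>\<alpha> m / D\<bar> \<le> 1/4" for m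
      using B[of m] D(1) \<open>D > 0\<close> by (simp add: abs_divide divide_le_eq)
    obtain t where "\<And>m. t + \<alpha> m / D \<in> A"
      using exists_translate_avoiding_balls[of r "3/8" N "\<lambda>m. \<alpha> m / D" q]
        r_sums tail short less_imp_le[OF r_pos] unfolding A_def by auto
    then show ?thesis
      using \<open>D > 0\<close> by (intro exI[of _ "1 / D"]) auto
  qed
  ultimately show ?thesis
    by (intro exI[of _ A]) (auto simp: A_def)
qed

end
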